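(* The number of weighted rooted trees of total weight $n$ containing a specified limb is independent of the structure of the limb: if $L_1$ and $L_2$ are weighted rooted trees, each with at least three vertices, having the same total weight $\ell$, then for every $n$ the number of weighted rooted trees of total weight $n$ that have $L_1$ as a limb equals the number of weighted rooted trees of total weight $n$ that have $L_2$ as a limb.
   Context: A weighted rooted tree is a finite rooted tree in which each vertex is assigned a positive integer weight. Its total weight is the sum of the weights of all its vertices. Weighted rooted trees are counted up to isomorphism preserving the root and the vertex weights. Let $T$ be a weighted rooted tree and $v\in V(T)$. A branch at $v$ is a weighted subtree of $T$, rooted at $v$, consisting of $v$, one child $v'$ of $v$, and all descendants of $v'$ in $T$, with weights inherited from $T$. A limb at $v$ is a weighted rooted subtree of $T$ with root $v$ that consists of a collection of branches at $v$. The tree $T$ has $L$ as a limb if for some $v\in V(T)$ there is a limb at $v$ isomorphic to $L$ as a weighted rooted tree. *)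

theory Defs
  imports Main
begin

text \<open>
  A rooted tree is represented by its vertex set, its root and the set of pairs
  (parent, child).  The value of \<open>tweight\<close> outside \<open>tverts\<close> is irrelevant.
\<close>

record 'a wrtree =
  tverts :: "'a set"
  tarcs :: "('a \<times> 'a) set"
  troot :: 'a
  tweight :: "'a \<Rightarrow> nat"

definition weighted_rooted_tree :: "'a wrtree \<Rightarrow> bool" where
  "weighted_rooted_tree T \<longleftrightarrow>
     finite (tverts T) \<and>
     troot T \<in> tverts T \<and>
     tarcs T \<subseteq> tverts T \<times> tverts T \<and>
     (\<forall>u. (u, troot T) \<notin> tarcs T) \<and>
     (\<forall>v \<in> tverts T - {troot T}. \<exists>!u. (u, v) \<in> tarcs T) \<and>
     (\<forall>v \<in> tverts T. (troot T, v) \<in> (tarcs T)\<^sup>*) \<and>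
     (\<forall>v \<in> tverts T. 0 < tweight T v)"

definition total_weight :: "'a wrtree \<Rightarrow> nat" where
  "total_weight T = (\<Sum>v \<in> tverts T. tweight T v)"

definition wrtree_iso :: "'a wrtree \<Rightarrow> 'b wrtree \<Rightarrow> bool" where
  "wrtree_iso S T \<longleftrightarrow>
     (\<exists>f. bij_betw f (tverts S) (tverts T) \<and>
          f (troot S) = troot T \<and>
          (\<forall>u \<in> tverts S. \<forall>v \<in> tverts S. (u, v) \<in> tarcs S \<longleftrightarrow> (f u, f v) \<in> tarcs T) \<and>
          (\<forall>v \<in> tverts S. tweight T (f v) = tweight S v))"

definition branch :: "'a wrtree \<Rightarrow> 'a \<Rightarrow> 'a \<Rightarrow> 'a wrtree" where
  "branch T v v' =
     (let U = insert v ((tarcs T)\<^sup>* `` {v'})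
      in \<lparr>tverts = U, tarcs = tarcs T \<inter> U \<times> U, troot = v, tweight = tweight T\<rparr>)"

definition branches :: "'a wrtree \<Rightarrow> 'a \<Rightarrow> 'a wrtree set" where
  "branches T v = {branch T v v' | v'. (v, v') \<in> tarcs T}"

text \<open>
  The vertex \<open>v\<close> is inserted explicitly only for the sake of the empty collection of
  branches, whose limb is the single vertex \<open>v\<close>.
\<close>

definition limbs :: "'a wrtree \<Rightarrow> 'a \<Rightarrow> 'a wrtree set" where
  "limbs T v =
     {\<lparr>tverts = insert v (\<Union>B \<in> \<B>. tverts B), tarcs = (\<Union>B \<in> \<B>. tarcs B),
       troot = v, tweight = tweight T\<rparr> | \<B>. \<B> \<subseteq> branches T v}"

definition has_limb :: "'a wrtree \<Rightarrow> 'b wrtree \<Rightarrow> bool" where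
  "has_limb T L \<longleftrightarrow> (\<exists>v \<in> tverts T. \<exists>M \<in> limbs T v. wrtree_iso M L)"

definition wrtree_iso_rel :: "('a wrtree \<times> 'a wrtree) set" where
  "wrtree_iso_rel =
     {(S, T). weighted_rooted_tree S \<and> weighted_rooted_tree T \<and> wrtree_iso S T}"

text \<open>
  Isomorphism classes are formed among the trees whose vertices are natural numbers.  By
  \<open>wrtree_iso_nat\<close> below these represent all weighted rooted trees, and by
  \<open>finite_wrtree_classes\<close> the cardinality below is that of a finite set.
\<close>

definition num_trees_with_limb :: "nat \<Rightarrow> 'b wrtree \<Rightarrow> nat" where
  "num_trees_with_limb n L =
     card ({T :: nat wrtree. weighted_rooted_tree T \<and> total_weight T = n \<and> has_limb T L}
           // wrtree_iso_rel)"

lemma wrtree_iso_refl: "wrtree_iso T T"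
  unfolding wrtree_iso_def by (intro exI[of _ id]) auto

lemma wrtree_iso_sym:
  assumes "weighted_rooted_tree S" and "wrtree_iso S T"
  shows "wrtree_iso T S"
proof -
  obtain f where f: "bij_betw f (tverts S) (tverts T)" "f (troot S) = troot T"
      "\<And>u v. u \<in> tverts S \<Longrightarrow> v \<in> tverts S \<Longrightarrow> (u, v) \<in> tarcs S \<longleftrightarrow> (f u, f v) \<in> tarcs T"
      "\<And>v. v \<in> tverts S \<Longrightarrow> tweight T (f v) = tweight S v"
    using assms(2) unfolding wrtree_iso_def by blast
  let ?g = "inv_into (tverts S) f"
  have g: "?g y \<in> tverts S" "f (?g y) = y" if "y \<in> tverts T" for y
    using that f(1) by (auto simp: bij_betw_def inv_into_into f_inv_into_f)
  have "troot S \<in> tverts S"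
    using assms(1) by (simp add: weighted_rooted_tree_def)
  then have "?g (troot T) = troot S"
    using f(1,2) by (metis bij_betw_inv_into_left)
  then show ?thesis
    unfolding wrtree_iso_def using bij_betw_inv_into[OF f(1)] f(3,4) g
    by (intro exI[of _ ?g]) metis
qed

lemma wrtree_iso_trans:
  assumes "wrtree_iso S T" and "wrtree_iso T U"
  shows "wrtree_iso S U"
proof -
  obtain f where f: "bij_betw f (tverts S) (tverts T)" "f (troot S) = troot T"
      "\<And>u v. u \<in> tverts S \<Longrightarrow> v \<in> tverts S \<Longrightarrow> (u, v) \<in> tarcs S \<longleftrightarrow> (f u, f v) \<in> tarcs T"
      "\<And>v. v \<in> tverts S \<Longrightarrow> tweight T (f v) = tweight S v"
    using assms(1) unfolding wrtree_iso_def by blast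
  obtain g where g: "bij_betw g (tverts T) (tverts U)" "g (troot T) = troot U"
      "\<And>u v. u \<in> tverts T \<Longrightarrow> v \<in> tverts T \<Longrightarrow> (u, v) \<in> tarcs T \<longleftrightarrow> (g u, g v) \<in> tarcs U"
      "\<And>v. v \<in> tverts T \<Longrightarrow> tweight U (g v) = tweight T v"
    using assms(2) unfolding wrtree_iso_def by blast
  have "f v \<in> tverts T" if "v \<in> tverts S" for v
    using that f(1) by (rule bij_betwE[THEN bspec, rotated])
  then show ?thesis
    unfolding wrtree_iso_def using bij_betw_trans[OF f(1) g(1)] f(2-4) g(2-4)
    by (intro exI[of _ "g \<circ> f"]) auto
qed

lemma equiv_wrtree_iso_rel: "equiv (Collect weighted_rooted_tree) wrtree_iso_rel"
  by (intro equivI refl_onI symI transI)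
     (auto simp: wrtree_iso_rel_def intro: wrtree_iso_refl wrtree_iso_sym wrtree_iso_trans)

lemma wrtree_iso_relabel:
  fixes T :: "'a wrtree" and f :: "'a \<Rightarrow> 'b"
  assumes T: "weighted_rooted_tree T" and f: "inj_on f (tverts T)"
  shows "\<exists>S. weighted_rooted_tree S \<and> wrtree_iso T S \<and> tverts S = f ` tverts T \<and>
             (\<forall>x. x \<notin> tverts S \<longrightarrow> tweight S x = 0)"
proof -
  let ?A = "map_prod f f ` tarcs T"
  define w where "w x = (if x \<in> f ` tverts T then tweight T (inv_into (tverts T) f x) else 0)" for x
  define S where "S = \<lparr>tverts = f ` tverts T, tarcs = ?A, troot = f (troot T), tweight = w\<rparr>"
  note t = T[unfolded weighted_rooted_tree_def]
  have A: "tarcs T \<subseteq> tverts T \<times> tverts T" and r: "troot T \<in> tverts T"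
    using t by auto
  have arc: "(f u, f v) \<in> ?A \<longleftrightarrow> (u, v) \<in> tarcs T" if "u \<in> tverts T" "v \<in> tverts T" for u v
    using that A f by (auto simp: inj_on_eq_iff)
  have w: "w (f v) = tweight T v" if "v \<in> tverts T" for v
    using that f by (simp add: w_def)
  have path: "(f u, f v) \<in> ?A\<^sup>*" if "(u, v) \<in> (tarcs T)\<^sup>*" for u v
    using that
  proof induction
    case (step y z)
    then have "(f y, f z) \<in> ?A" by force
    with step.IH show ?case by (rule rtrancl_into_rtrancl)
  qed simp
  have "\<exists>!y. (y, x) \<in> ?A" if x: "x \<in> f ` tverts T - {f (troot T)}" for x
  proof -
    obtain v where v: "v \<in> tverts T - {troot T}" "x = f v" using x by blast
    then obtain u where u: "(u, v) \<in> tarcs T" "\<And>u'. (u', v) \<in> tarcs T \<Longrightarrow> u' = u"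
      using t by blast
    show ?thesis
    proof
      show "(f u, x) \<in> ?A" using u(1) v(2) by force
    next
      fix y assume "(y, x) \<in> ?A"
      then obtain u' v' where "(u', v') \<in> tarcs T" "y = f u'" "x = f v'" by auto
      moreover from this have "v' = v" using v A f by (auto dest: inj_onD)
      ultimately show "y = f u" using u(2) by blast
    qed
  qed
  moreover have "(y, f (troot T)) \<notin> ?A" for y
  proof
    assume "(y, f (troot T)) \<in> ?A"
    then obtain u v where "(u, v) \<in> tarcs T" "f (troot T) = f v" by auto
    moreover from this have "v = troot T" using r A f by (auto dest: inj_onD)
    ultimately show False using t by blast
  qed
  ultimately have "weighted_rooted_tree S"
    using t A w path unfolding weighted_rooted_tree_def S_def by auto
  moreover have "wrtree_iso T S"
    unfolding wrtree_iso_def S_def using f arc w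
    by (intro exI[of _ f]) (auto simp: bij_betw_def)
  ultimately show ?thesis
    by (auto simp: S_def w_def)
qed

lemma wrtree_iso_nat:
  fixes T :: "'a wrtree"
  assumes "weighted_rooted_tree T"
  shows "\<exists>S :: nat wrtree. weighted_rooted_tree S \<and> wrtree_iso T S \<and>
           tverts S = {..<card (tverts T)} \<and> (\<forall>x. x \<notin> tverts S \<longrightarrow> tweight S x = 0)"
proof -
  have "finite (tverts T)" using assms by (simp add: weighted_rooted_tree_def)
  from ex_bij_betw_finite_nat[OF this] obtain f
    where "bij_betw f (tverts T) {0..<card (tverts T)}" by blast
  then have "inj_on f (tverts T)" "f ` tverts T = {..<card (tverts T)}"
    by (auto simp: bij_betw_def lessThan_atLeast0)
  with wrtree_iso_relabel[OF assms, of f] show ?thesis by simp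
qed

lemma wrtree_iso_total_weight:
  assumes "wrtree_iso S T"
  shows "total_weight S = total_weight T"
proof -
  obtain f where f: "bij_betw f (tverts S) (tverts T)"
      "\<And>v. v \<in> tverts S \<Longrightarrow> tweight T (f v) = tweight S v"
    using assms unfolding wrtree_iso_def by blast
  show ?thesis
    unfolding total_weight_def using sum.reindex_bij_betw[OF f(1), of "tweight T"] f(2) by simp
qed

lemma finite_wrtree_classes:
  "finite ({T :: nat wrtree. weighted_rooted_tree T \<and> total_weight T = n} // wrtree_iso_rel)"
proof -
  let ?W = "{w. w ` {..<n} \<subseteq> {..n} \<and> (\<forall>x. x \<notin> {..<n} \<longrightarrow> w x = 0)}"
  let ?F = "(\<lambda>(V, A, r, w). \<lparr>tverts = V, tarcs = A, troot = r, tweight = w\<rparr>) `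
      (Pow {..<n} \<times> Pow ({..<n} \<times> {..<n}) \<times> {..<n} \<times> ?W)"
  have "finite ?W"
    by (rule finite_subset[OF _ finite_set_of_finite_funs[of "{..<n}" "{..n}" "0::nat"]]) auto
  then have F: "finite ?F" by (intro finite_imageI finite_cartesian_product) auto
  have "X \<in> (\<lambda>S. wrtree_iso_rel `` {S}) ` ?F"
    if X: "X \<in> {T :: nat wrtree. weighted_rooted_tree T \<and> total_weight T = n} // wrtree_iso_rel"
    for X
  proof -
    obtain T :: "nat wrtree" where T: "weighted_rooted_tree T" "total_weight T = n"
        "X = wrtree_iso_rel `` {T}"
      using X by (auto elim: quotientE)
    obtain S :: "nat wrtree" where S: "weighted_rooted_tree S" "wrtree_iso T S"
        "tverts S = {..<card (tverts T)}" "\<And>x. x \<notin> tverts S \<Longrightarrow> tweight S x = 0"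
      using wrtree_iso_nat[OF T(1)] by blast
    note s = S(1)[unfolded weighted_rooted_tree_def]
    have n: "(\<Sum>v \<in> tverts S. tweight S v) = n"
      using wrtree_iso_total_weight[OF S(2)] T(2) by (simp add: total_weight_def)
    have "card (tverts S) \<le> (\<Sum>v \<in> tverts S. tweight S v)"
      using s sum_mono[of "tverts S" "\<lambda>_. 1" "tweight S"] by (simp add: Suc_le_eq)
    then have V: "tverts S \<subseteq> {..<n}" using n S(3) by simp
    have w: "tweight S x \<le> n" for x
    proof (cases "x \<in> tverts S")
      case True
      then show ?thesis using s n member_le_sum[of x "tverts S" "tweight S"] by simp
    qed (simp add: S(4))
    have w0: "tweight S x = 0" if "x \<notin> {..<n}" for x
      using that V S(4) by blast
    have "S \<in> ?F"
    proof (rule image_eqI)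
      show "S = (\<lambda>(V, A, r, w). \<lparr>tverts = V, tarcs = A, troot = r, tweight = w\<rparr>)
          (tverts S, tarcs S, troot S, tweight S)" by simp
      show "(tverts S, tarcs S, troot S, tweight S) \<in>
          Pow {..<n} \<times> Pow ({..<n} \<times> {..<n}) \<times> {..<n} \<times> ?W"
        using s V w w0 by (auto 0 3)
    qed
    moreover have "X = wrtree_iso_rel `` {S}"
      unfolding T(3) using T(1) S(1,2)
      by (intro equiv_class_eq[OF equiv_wrtree_iso_rel]) (simp add: wrtree_iso_rel_def)
    ultimately show ?thesis by blast
  qed
  then show ?thesis by (intro finite_subset[OF _ finite_imageI[OF F]]) blast
qed

end

theory Submission
  imports Defs "HOL-Library.Multiset"
begin

text \<open>
  Let \<open>L\<close> have total weight \<open>\<ell>\<close>, root weight \<open>w\<close> and multiset \<open>K\<close> of subtrees at the children of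
  the root.  If the subtrees at the children of the root of a tree \<open>t\<close>
  all avoid \<open>L\<close>, then \<open>t\<close> has \<open>L\<close> as a limb exactly if its root has weight \<open>w\<close> and the multiset of these subtrees is \<open>K + M\<close> for some \<open>M\<close>.  Since \<open>K\<close> itself
  consists of trees too light to contain \<open>L\<close>, \<open>M\<close> ranges over all multisets of \<open>L\<close>-avoiding trees
  of total weight \<open>n - \<ell>\<close> when \<open>t\<close> has weight \<open>n\<close>.  So the generating function \<open>A\<close> of the \<open>L\<close>-avoiding trees satisfies
  \<open>A = (x / (1 - x) - x\<^sup>\<ell>) exp (\<Sum>k \<ge> 1. A(x\<^sup>k) / k)\<close>, which determines \<open>A\<close> and mentions only \<open>\<ell>\<close>.
  Instead of power series, the counts for two limbs are compared by
  induction on \<open>n\<close>: weight-preserving bijections between lighter avoiding trees extend to multisets.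
\<close>

section \<open>Counting limb-avoiding trees\<close>

text \<open>Hereditary multisets model unordered trees: children carry neither names nor an order,
  so equality takes the place of isomorphism. Zero weights are representable and are excluded by
  \<open>positive\<close>.\<close>

datatype wtree = Node (rweight: nat) (kids: "wtree multiset")

primrec tweight_sum :: "wtree \<Rightarrow> nat" where
  "tweight_sum (Node w M) = w + sum_mset (image_mset tweight_sum M)"

primrec positive :: "wtree \<Rightarrow> bool" where
  "positive (Node w M) \<longleftrightarrow> 0 < w \<and> (\<forall>b \<in># image_mset positive M. b)"

text \<open>A limb keeps a vertex and some entire branches there, so at the root it amounts to a
  submultiset of the child subtrees; \<open>there\<close> moves on to the other vertices.\<close>

inductive contains_limb :: "wtree \<Rightarrow> wtree \<Rightarrow> bool" for L where
  here: "rweight t = rweight L \<Longrightarrow> kids L \<subseteq># kids t \<Longrightarrow> contains_limb L t"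
| there: "s \<in># kids t \<Longrightarrow> contains_limb L s \<Longrightarrow> contains_limb L t"

lemma kid_weight_le: "s \<in># kids t \<Longrightarrow> tweight_sum s \<le> sum_mset (image_mset tweight_sum (kids t))"
  by (metis multi_member_split image_mset_add_mset le_add1 sum_mset.add_mset)

lemma weight_kids: "tweight_sum t = rweight t + sum_mset (image_mset tweight_sum (kids t))"
  by (cases t) simp

lemma positive_iff: "positive t \<longleftrightarrow> 0 < rweight t \<and> (\<forall>s \<in># kids t. positive s)"
  by (cases t) auto

lemma contains_limb_weight:
  "contains_limb L t \<Longrightarrow> tweight_sum L \<le> tweight_sum t"
proof (induction rule: contains_limb.induct)
  case (here t)
  then obtain M where "kids t = kids L + M" by (auto simp: subset_mset.le_iff_add)
  with here show ?case by (simp add: weight_kids[of t] weight_kids[of L])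
next
  case (there s t)
  then show ?case using kid_weight_le[of s t] weight_kids[of t] by simp
qed

lemma card_avoiding_eq:
  fixes L1 L2 :: wtree
  defines "A \<equiv> \<lambda>L n. {t. positive t \<and> tweight_sum t = n \<and> \<not> contains_limb L t}"
  assumes fin: "\<And>n. finite {t. positive t \<and> tweight_sum t = n}"
    and L: "positive L1" "positive L2" "tweight_sum L1 = tweight_sum L2"
  shows "card (A L1 n) = card (A L2 n)"
proof (induction n rule: less_induct)
  case (less n)
  have finA: "finite (A L m)" for L m
    using fin[of m] by (rule rev_finite_subset) (auto simp: A_def)
  \<comment> \<open>\<open>F\<close> collects forests of avoiding trees. In \<open>P\<close>
    avoidance is required only below the root, so members of \<open>Q\<close> have the limb at the
    root itself, and the avoiding trees of weight \<open>n\<close> are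
    \<open>P L - Q L\<close>.\<close>
  define F where "F L k = {M. (\<forall>s \<in># M. positive s \<and> \<not> contains_limb L s) \<and>
      sum_mset (image_mset tweight_sum M) = k}" for L k
  define P where "P L = {t. positive t \<and> tweight_sum t = n \<and> (\<forall>s \<in># kids t. \<not> contains_limb L s)}" for L
  define Q where "Q L = {t \<in> P L. contains_limb L t}" for L
  have A: "card (A L n) = card (P L) - card (Q L)" for L
  proof -
    have "A L n = P L - Q L"
      by (auto simp: A_def P_def Q_def intro: contains_limb.there)
    moreover have "finite (P L)"
      using fin[of n] by (rule rev_finite_subset) (auto simp: P_def)
    ultimately show ?thesis
      by (simp add: card_Diff_subset Q_def)
  qed
  have Q: "card (Q L) = (if tweight_sum L \<le> n then card (F L (n - tweight_sum L)) else 0)"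
    if "positive L" for L
  proof -
    \<comment> \<open>The root of \<open>L\<close> has positive weight, so a child subtree is
      strictly lighter than \<open>L\<close>.\<close>
    have kidL: "\<not> contains_limb L s" if "s \<in># kids L" for s
    proof
      assume "contains_limb L s"
      with contains_limb_weight[OF this] kid_weight_le[OF that] weight_kids[of L] \<open>positive L\<close>
      show False by (simp add: positive_iff[of L])
    qed
    have "Q L = (\<lambda>M. Node (rweight L) (kids L + M)) `
        (if tweight_sum L \<le> n then F L (n - tweight_sum L) else {})" (is "_ = ?g ` ?D")
    proof (intro equalityI subsetI)
      fix t assume t: "t \<in> Q L"
      then have c: "contains_limb L t" and p: "t \<in> P L" by (auto simp: Q_def)
      \<comment> \<open>Membership in \<open>P L\<close> rules out the case
        \<open>there\<close>.\<close>
      from c p have r: "rweight t = rweight L" "kids L \<subseteq># kids t"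
        by (cases; auto simp: P_def)+
      then obtain M where M: "kids t = kids L + M"
        by (auto simp: subset_mset.le_iff_add)
      have "tweight_sum L \<le> n" using contains_limb_weight[OF c] p by (simp add: P_def)
      moreover have "M \<in> F L (n - tweight_sum L)"
        using p M r(1) weight_kids[of t] weight_kids[of L] by (auto simp: F_def P_def positive_iff[of t])
      moreover have "t = ?g M" using M r by (cases t) auto
      ultimately show "t \<in> ?g ` ?D" by auto
    next
      fix t assume "t \<in> ?g ` ?D"
      then obtain M where le: "tweight_sum L \<le> n" and M: "M \<in> F L (n - tweight_sum L)"
        and t: "t = ?g M" by (auto split: if_splits)
      have "contains_limb L t" unfolding t by (rule contains_limb.here) auto
      moreover have "t \<in> P L"
        using M le that kidL weight_kids[of L] unfolding P_def t F_def
        by (auto simp: positive_iff[of L])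
      ultimately show "t \<in> Q L" by (simp add: Q_def)
    qed
    moreover have "inj_on ?g X" for X by (auto intro: inj_onI)
    ultimately show ?thesis by (simp add: card_image)
  qed
  have "\<exists>\<phi>. bij_betw \<phi> (A L1 m) (A L2 m)" if "m < n" for m
    using less[OF that] finA finite_same_card_bij by blast
  then obtain \<psi> where \<psi>: "\<And>m. m < n \<Longrightarrow> bij_betw (\<psi> m) (A L1 m) (A L2 m)" by metis
  \<comment> \<open>The bijections for the separate weights are glued into one map with an explicit
    inverse; both are then applied entrywise to forests of weight below \<open>n\<close>.\<close>
  define \<phi> where "\<phi> t = \<psi> (tweight_sum t) t" for t
  define \<phi>' where "\<phi>' t = inv_into (A L1 (tweight_sum t)) (\<psi> (tweight_sum t)) t" for t
  have \<phi>: "positive (\<phi> t) \<and> tweight_sum (\<phi> t) = tweight_sum t \<and> \<not> contains_limb L2 (\<phi> t) \<and> \<phi>' (\<phi> t) = t"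
    if "positive t" "\<not> contains_limb L1 t" "tweight_sum t < n" for t
  proof -
    have t: "t \<in> A L1 (tweight_sum t)" using that by (simp add: A_def)
    then have "\<phi> t \<in> A L2 (tweight_sum t)"
      using bij_betwE[OF \<psi>[OF that(3)]] by (simp add: \<phi>_def)
    then show ?thesis
      using t bij_betw_inv_into_left[OF \<psi>[OF that(3)]] by (auto simp: A_def \<phi>_def \<phi>'_def)
  qed
  have \<phi>': "positive (\<phi>' t) \<and> tweight_sum (\<phi>' t) = tweight_sum t \<and> \<not> contains_limb L1 (\<phi>' t) \<and> \<phi> (\<phi>' t) = t"
    if "positive t" "\<not> contains_limb L2 t" "tweight_sum t < n" for t
  proof -
    have t: "t \<in> A L2 (tweight_sum t)" using that by (simp add: A_def)
    then have "\<phi>' t \<in> A L1 (tweight_sum t)"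
      using bij_betwE[OF bij_betw_inv_into[OF \<psi>[OF that(3)]]] by (simp add: \<phi>'_def)
    then show ?thesis
      using t bij_betw_inv_into_right[OF \<psi>[OF that(3)]] by (auto simp: A_def \<phi>_def \<phi>'_def)
  qed
  have lt: "tweight_sum s < n" if "sum_mset (image_mset tweight_sum M) < n" "s \<in># M" for s M
    \<comment> \<open>An auxiliary root of weight 0 turns the forest into a tree.\<close>
    using kid_weight_le[of s "Node 0 M"] that by simp
  \<comment> \<open>Kept generic in \<open>f\<close> and \<open>g\<close> so that it serves for both
    directions of the bijection.\<close>
  have img: "image_mset f M \<in> F L' k \<and> image_mset g (image_mset f M) = M"
    if M: "M \<in> F L k" and k: "k < n"
      and f: "\<And>t. positive t \<Longrightarrow> \<not> contains_limb L t \<Longrightarrow> tweight_sum t < n \<Longrightarrow>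
        positive (f t) \<and> tweight_sum (f t) = tweight_sum t \<and> \<not> contains_limb L' (f t) \<and> g (f t) = t"
    for f g :: "wtree \<Rightarrow> wtree" and L L' M k
  proof -
    have s: "positive (f s) \<and> tweight_sum (f s) = tweight_sum s \<and> \<not> contains_limb L' (f s) \<and> g (f s) = s"
      if "s \<in># M" for s
      using f[of s] lt[of M s] that M k by (auto simp: F_def)
    then have "image_mset (\<lambda>s. tweight_sum (f s)) M = image_mset tweight_sum M"
      "image_mset (\<lambda>s. g (f s)) M = M"
      using image_mset_cong[of M "\<lambda>s. g (f s)" "\<lambda>s. s"] by (auto intro!: image_mset_cong)
    then show ?thesis using M s by (auto simp: F_def multiset.map_comp comp_def)
  qed
  have FF: "card (F L1 k) = card (F L2 k)" if "k < n" for k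
    by (rule bij_betw_same_card[of "image_mset \<phi>"], rule bij_betw_byWitness[where f' = "image_mset \<phi>'"])
      (use img[of _ L1 k \<phi> L2 \<phi>'] img[of _ L2 k \<phi>' L1 \<phi>] \<phi> \<phi>' that in auto)
  \<comment> \<open>The root weight is positive, so the children have total weight
    \<open>n - w < n\<close>, within reach of the induction hypothesis.\<close>
  have Pn: "t \<in> P L \<longleftrightarrow> (\<exists>w M. t = Node w M \<and> 0 < w \<and> w \<le> n \<and> M \<in> F L (n - w))" for t L
    by (cases t) (auto simp: P_def F_def)
  have step: "Node w (image_mset f M) \<in> P L' \<and> image_mset g (image_mset f M) = M"
    if "Node w M \<in> P L"
      and f: "\<And>t. positive t \<Longrightarrow> \<not> contains_limb L t \<Longrightarrow> tweight_sum t < n \<Longrightarrow>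
        positive (f t) \<and> tweight_sum (f t) = tweight_sum t \<and> \<not> contains_limb L' (f t) \<and> g (f t) = t"
    for f g :: "wtree \<Rightarrow> wtree" and L L' M w
    using img[of M L "n - w" f L' g] that(1) f unfolding Pn by auto
  have PP: "card (P L1) = card (P L2)"
  proof (rule bij_betw_same_card, rule bij_betw_byWitness)
    let ?f = "\<lambda>t. Node (rweight t) (image_mset \<phi> (kids t))"
    let ?g = "\<lambda>t. Node (rweight t) (image_mset \<phi>' (kids t))"
    have 1: "?f t \<in> P L2 \<and> ?g (?f t) = t" if "t \<in> P L1" for t
      using step[of "rweight t" "kids t" L1 \<phi> L2 \<phi>'] that \<phi> by simp
    have 2: "?g t \<in> P L1 \<and> ?f (?g t) = t" if "t \<in> P L2" for t
      using step[of "rweight t" "kids t" L2 \<phi>' L1 \<phi>] that \<phi>' by simp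
    show "\<forall>t \<in> P L1. ?g (?f t) = t" "\<forall>t \<in> P L2. ?f (?g t) = t" "?f ` P L1 \<subseteq> P L2" "?g ` P L2 \<subseteq> P L1"
      using 1 2 by blast+
  qed
  have "card (Q L1) = card (Q L2)"
  proof -
    \<comment> \<open>Ensures \<open>n - tweight_sum L2 < n\<close> whenever the limb fits, as
      \<open>FF\<close> demands.\<close>
    have "0 < tweight_sum L2" using L(2) weight_kids[of L2] by (simp add: positive_iff[of L2])
    then show ?thesis
      using FF[of "n - tweight_sum L2"] by (simp add: Q L)
  qed
  with PP show ?case by (simp add: A)
qed

section \<open>Isomorphism classes as hereditary multisets\<close>

lemma wrtree_arcs_subset: "weighted_rooted_tree T \<Longrightarrow> tarcs T \<subseteq> tverts T \<times> tverts T"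
  by (simp add: weighted_rooted_tree_def)

lemma finite_tverts: "weighted_rooted_tree T \<Longrightarrow> finite (tverts T)"
  by (simp add: weighted_rooted_tree_def)

lemma troot_in_tverts: "weighted_rooted_tree T \<Longrightarrow> troot T \<in> tverts T"
  by (simp add: weighted_rooted_tree_def)

lemma finite_tarcs: "weighted_rooted_tree T \<Longrightarrow> finite (tarcs T)"
  by (blast intro: finite_subset[OF wrtree_arcs_subset] finite_tverts)

lemma finite_children: "weighted_rooted_tree T \<Longrightarrow> finite (tarcs T `` {v})"
  using finite_tarcs by (metis finite_Image)

lemma parent_unique:
  assumes "weighted_rooted_tree T" and "(u, v) \<in> tarcs T" and "(u', v) \<in> tarcs T"
  shows "u = u'"
proof -
  have "v \<in> tverts T - {troot T}"
    using assms by (auto simp: weighted_rooted_tree_def)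
  then have "\<exists>!u. (u, v) \<in> tarcs T"
    using assms(1) unfolding weighted_rooted_tree_def by blast
  then show ?thesis using assms(2,3) by blast
qed

text \<open>Induction along the path from the root: a cycle through \<open>z\<close> must enter
  \<open>z\<close> from its only parent \<open>y\<close>, so it also passes through
  \<open>y\<close>. No arc enters the root, which starts the induction.\<close>

lemma acyclic_tarcs:
  assumes T: "weighted_rooted_tree T"
  shows "acyclic (tarcs T)"
proof -
  have no_cycle: "(v, v) \<notin> (tarcs T)\<^sup>+" if "(troot T, v) \<in> (tarcs T)\<^sup>*" for v
    using that
  proof induction
    case base
    show ?case
      using T by (auto simp: weighted_rooted_tree_def elim: tranclE)
  next
    case (step y z)
    show ?case
    proof
      assume "(z, z) \<in> (tarcs T)\<^sup>+"
      then obtain u where "(z, u) \<in> (tarcs T)\<^sup>*" "(u, z) \<in> tarcs T"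
        by (meson tranclD2)
      then have "(z, y) \<in> (tarcs T)\<^sup>*"
        using parent_unique[OF T] step.hyps(2) by blast
      then show False using step by (meson rtrancl_into_trancl2)
    qed
  qed
  have "v \<in> tverts T" if "(v, v) \<in> (tarcs T)\<^sup>+" for v
    using that wrtree_arcs_subset[OF T] by (auto dest!: tranclD)
  then show ?thesis
    using no_cycle T unfolding acyclic_def weighted_rooted_tree_def by blast
qed

lemma wf_tarcs: "weighted_rooted_tree T \<Longrightarrow> wf (tarcs T)"
  by (simp add: acyclic_tarcs finite_acyclic_wf finite_tarcs)

lemma wf_tarcs_converse: "weighted_rooted_tree T \<Longrightarrow> wf ((tarcs T)\<inverse>)"
  by (simp add: acyclic_tarcs finite_acyclic_wf_converse finite_tarcs)

text \<open>The canonical form of the subtree below a vertex. Recursion runs from the leaves upward,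
  along the converse arcs, which are well-founded because the tree is finite and acyclic.\<close>

definition canon :: "'a wrtree \<Rightarrow> 'a \<Rightarrow> wtree" where
  "canon T = wfrec ((tarcs T)\<inverse>)
     (\<lambda>f v. Node (tweight T v) (image_mset f (mset_set (tarcs T `` {v}))))"

lemma canon_eq:
  assumes T: "weighted_rooted_tree T"
  shows "canon T v = Node (tweight T v) (image_mset (canon T) (mset_set (tarcs T `` {v})))"
proof -
  have "canon T v = Node (tweight T v)
      (image_mset (cut (canon T) ((tarcs T)\<inverse>) v) (mset_set (tarcs T `` {v})))"
    unfolding canon_def by (subst wfrec[OF wf_tarcs_converse[OF T]]) simp
  also have "image_mset (cut (canon T) ((tarcs T)\<inverse>) v) (mset_set (tarcs T `` {v})) =
      image_mset (canon T) (mset_set (tarcs T `` {v}))"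
    using finite_children[OF T] by (intro image_mset_cong) (simp add: cut_def)
  finally show ?thesis .
qed

lemma rweight_canon: "weighted_rooted_tree T \<Longrightarrow> rweight (canon T v) = tweight T v"
  by (simp add: canon_eq)

lemma kids_canon:
  "weighted_rooted_tree T \<Longrightarrow> kids (canon T v) = image_mset (canon T) (mset_set (tarcs T `` {v}))"
  by (simp add: canon_eq)

text \<open>A canonical form depends only on what lies below the vertex, so a child-closed domain
  \<open>D\<close> suffices. With \<open>D\<close> the whole vertex set this covers isomorphisms;
  with \<open>f\<close> the identity it compares a limb with the ambient tree.\<close>

lemma canon_transfer:
  assumes S: "weighted_rooted_tree S" and T: "weighted_rooted_tree T"
    and inj: "inj_on f D"
    and closed: "\<And>u. u \<in> D \<Longrightarrow> tarcs S `` {u} \<subseteq> D"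
    and arcs: "\<And>u. u \<in> D \<Longrightarrow> tarcs T `` {f u} = f ` (tarcs S `` {u})"
    and weight: "\<And>u. u \<in> D \<Longrightarrow> tweight T (f u) = tweight S u"
    and "u \<in> D"
  shows "canon T (f u) = canon S u"
  using \<open>u \<in> D\<close>
proof (induction u rule: wf_induct_rule[OF wf_tarcs_converse[OF S]])
  case (1 u)
  have "inj_on f (tarcs S `` {u})"
    using inj closed[OF 1(2)] by (rule inj_on_subset)
  then have "image_mset (canon T) (mset_set (tarcs T `` {f u})) =
      image_mset (\<lambda>c. canon T (f c)) (mset_set (tarcs S `` {u}))"
    by (simp add: arcs[OF 1(2)] image_mset_mset_set[symmetric] multiset.map_comp comp_def)
  also have "\<dots> = image_mset (canon S) (mset_set (tarcs S `` {u}))"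
    using finite_children[OF S] closed[OF 1(2)] 1(1) by (intro image_mset_cong) auto
  finally show ?case
    using weight[OF 1(2)] by (simp add: canon_eq[OF S, of u] canon_eq[OF T, of "f u"])
qed

lemma canon_iso:
  assumes S: "weighted_rooted_tree S" and T: "weighted_rooted_tree T" and "wrtree_iso S T"
  shows "canon T (troot T) = canon S (troot S)"
proof -
  obtain f where f: "bij_betw f (tverts S) (tverts T)" "f (troot S) = troot T"
      "\<And>u v. u \<in> tverts S \<Longrightarrow> v \<in> tverts S \<Longrightarrow> (u, v) \<in> tarcs S \<longleftrightarrow> (f u, f v) \<in> tarcs T"
      "\<And>v. v \<in> tverts S \<Longrightarrow> tweight T (f v) = tweight S v"
    using assms(3) unfolding wrtree_iso_def by blast
  have "tarcs T `` {f u} = f ` (tarcs S `` {u})" if u: "u \<in> tverts S" for u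
  proof (intro equalityI subsetI)
    fix x assume x: "x \<in> tarcs T `` {f u}"
    then have "x \<in> f ` tverts S"
      using wrtree_arcs_subset[OF T] f(1) by (auto simp: bij_betw_def)
    then show "x \<in> f ` (tarcs S `` {u})" using x f(3) u by auto
  next
    fix x assume "x \<in> f ` (tarcs S `` {u})"
    then show "x \<in> tarcs T `` {f u}" using f(3) u wrtree_arcs_subset[OF S] by auto
  qed
  then have "canon T (f (troot S)) = canon S (troot S)"
    using f(1,4) wrtree_arcs_subset[OF S] troot_in_tverts[OF S]
    by (intro canon_transfer[OF S T, of f "tverts S"]) (auto simp: bij_betw_def)
  then show ?thesis using f(2) by simp
qed

text \<open>Match \<open>a\<close> with some \<open>b\<close> of the same value, cancel both from
  the multisets, and continue by induction.\<close>

lemma bij_betw_of_image_mset_eq: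
  assumes "finite A" "finite B" "image_mset f (mset_set A) = image_mset g (mset_set B)"
  shows "\<exists>h. bij_betw h A B \<and> (\<forall>a \<in> A. g (h a) = f a)"
  using assms
proof (induction A arbitrary: B)
  case empty
  then have "B = {}" by (simp add: mset_set_empty_iff)
  then show ?case by (auto simp: bij_betw_def)
next
  case (insert a A)
  then have "f a \<in># image_mset g (mset_set B)" by (metis finite_set_mset_mset_set
        finite.insertI image_eqI insertI1 set_image_mset)
  then obtain b where b: "b \<in> B" "g b = f a" using insert.prems by auto
  then have B: "mset_set B = add_mset b (mset_set (B - {b}))"
    using insert.prems by (simp add: mset_set.remove)
  have "image_mset f (mset_set A) = image_mset g (mset_set (B - {b}))"
    using insert.prems(2) insert.hyps b B by simp
  then obtain h where h: "bij_betw h A (B - {b})" "\<forall>a \<in> A. g (h a) = f a"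
    using insert.IH[of "B - {b}"] insert.prems(1) by blast
  have "bij_betw (h(a := b)) A (B - {b})"
    using h(1) insert.hyps(2) by (subst bij_betw_cong[of _ _ h]) auto
  then have "bij_betw (h(a := b)) (insert a A) (insert b (B - {b}))"
    using insert.hyps(2) notIn_Un_bij_betw[of a A "h(a := b)" "B - {b}"] by simp
  then have "bij_betw (h(a := b)) (insert a A) B"
    by (simp only: insert_Diff[OF b(1)])
  moreover have "\<forall>x \<in> insert a A. g ((h(a := b)) x) = f x"
    using h(2) b(2) by simp
  ultimately show ?case by blast
qed

text \<open>The isomorphism is built from the root downward. Equal canonical forms at
  \<open>u\<close> and \<open>x\<close> give a form-preserving bijection \<open>h u x\<close>
  between their children; \<open>f\<close> sends the children of \<open>u\<close> along
  \<open>h u (f u)\<close>.\<close>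

lemma iso_of_canon_eq:
  assumes S: "weighted_rooted_tree S" and T: "weighted_rooted_tree T"
    and eq: "canon S (troot S) = canon T (troot T)"
  shows "wrtree_iso S T"
proof -
  have "\<exists>h. bij_betw h (tarcs S `` {u}) (tarcs T `` {x}) \<and>
      (\<forall>c \<in> tarcs S `` {u}. canon T (h c) = canon S c)"
    if "canon S u = canon T x" for u x
    using that finite_children[OF S] finite_children[OF T]
    by (intro bij_betw_of_image_mset_eq) (simp_all add: canon_eq[OF S, of u] canon_eq[OF T, of x])
  then obtain h where
    h: "\<And>u x. canon S u = canon T x \<Longrightarrow> bij_betw (h u x) (tarcs S `` {u}) (tarcs T `` {x})"
      "\<And>u x c. canon S u = canon T x \<Longrightarrow> (u, c) \<in> tarcs S \<Longrightarrow> canon T (h u x c) = canon S c"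
    by (metis Image_singleton_iff)
  define par where "par c = (THE u. (u, c) \<in> tarcs S)" for c
  have par: "par c = u" if "(u, c) \<in> tarcs S" for u c
    using that parent_unique[OF S] unfolding par_def by blast
  have rootS: "(u, troot S) \<notin> tarcs S" for u
    using S by (simp add: weighted_rooted_tree_def)
  have rootT: "(u, troot T) \<notin> tarcs T" for u
    using T by (simp add: weighted_rooted_tree_def)
  \<comment> \<open>Here recursion follows the arcs themselves: the image of a vertex is computed
    from the image of its parent.\<close>
  define f where "f = wfrec (tarcs S)
    (\<lambda>g c. if c = troot S then troot T else h (par c) (g (par c)) c)"
  have f_root: "f (troot S) = troot T"
    unfolding f_def by (subst wfrec[OF wf_tarcs[OF S]]) simp
  have f_step: "f c = h u (f u) c" if "(u, c) \<in> tarcs S" for u c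
    unfolding f_def using that rootS
    by (subst wfrec[OF wf_tarcs[OF S]]) (auto simp: par cut_def)
  have reachS: "(troot S, v) \<in> (tarcs S)\<^sup>*" if "v \<in> tverts S" for v
    using S that by (simp add: weighted_rooted_tree_def)
  have canon_f: "canon S v = canon T (f v)" if "(troot S, v) \<in> (tarcs S)\<^sup>*" for v
    using that by induction (simp_all add: f_root eq f_step h(2))
  have f_arc: "(f u, f v) \<in> tarcs T" if "(u, v) \<in> tarcs S" for u v
  proof -
    have "u \<in> tverts S" using that wrtree_arcs_subset[OF S] by blast
    from bij_betwE[OF h(1)[OF canon_f[OF reachS[OF this]]]] that show ?thesis
      by (auto simp: f_step)
  qed
  have f_arc_ex: "\<exists>v. (u, v) \<in> tarcs S \<and> x = f v" if "(f u, x) \<in> tarcs T" "u \<in> tverts S" for u x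
  proof -
    have "bij_betw (h u (f u)) (tarcs S `` {u}) (tarcs T `` {f u})"
      using h(1) canon_f reachS that(2) by blast
    then have "x \<in> h u (f u) ` (tarcs S `` {u})" using that(1) by (simp add: bij_betw_def)
    then show ?thesis using f_step by auto
  qed
  \<comment> \<open>Vertices with a common image have parents with a common image, since parents in
    \<open>T\<close> are unique. By induction the parents coincide, and \<open>h\<close> is
    injective on their children.\<close>
  have inj: "v = v'" if "(troot S, v) \<in> (tarcs S)\<^sup>*" "v' \<in> tverts S" "f v = f v'" for v v'
    using that
  proof (induction arbitrary: v')
    case base
    show ?case
    proof (rule ccontr)
      assume "troot S \<noteq> v'"
      then obtain u where "(u, v') \<in> tarcs S"
        using reachS[OF base.prems(1)] by (metis rtranclE)
      then show False using f_arc rootT base.prems(2) f_root by metis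
    qed
  next
    case (step y z)
    have "v' \<noteq> troot S"
      using step f_arc f_root rootT by metis
    then obtain u where u: "(u, v') \<in> tarcs S"
      using reachS[OF step.prems(1)] by (metis rtranclE)
    then have "u \<in> tverts S" using wrtree_arcs_subset[OF S] by blast
    have "f y = f u"
      using f_arc[OF u] f_arc[OF step.hyps(2)] step.prems(2) parent_unique[OF T] by metis
    with step.IH[OF \<open>u \<in> tverts S\<close>] have "y = u" by blast
    have "inj_on (h y (f y)) (tarcs S `` {y})"
      using h(1)[OF canon_f[OF step.hyps(1)]] by (simp add: bij_betw_def)
    then show ?case
      using step u f_step \<open>y = u\<close> by (auto dest: inj_onD)
  qed
  have f_verts: "f v \<in> tverts T" if "v \<in> tverts S" for v
  proof (cases "v = troot S")
    case True
    then show ?thesis using f_root troot_in_tverts[OF T] by simp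
  next
    case False
    then obtain u where "(u, v) \<in> tarcs S" using reachS[OF \<open>v \<in> tverts S\<close>] by (metis rtranclE)
    then show ?thesis using f_arc wrtree_arcs_subset[OF T] by blast
  qed
  have surj: "x \<in> f ` tverts S" if "(troot T, x) \<in> (tarcs T)\<^sup>*" for x
    using that
  proof induction
    case base
    then show ?case using f_root troot_in_tverts[OF S] by (metis image_eqI)
  next
    case (step y z)
    then obtain u where "u \<in> tverts S" "y = f u" by blast
    with f_arc_ex[of u z] step.hyps show ?case
      using wrtree_arcs_subset[OF S] by auto
  qed
  have inj_f: "inj_on f (tverts S)"
    using inj reachS by (auto intro!: inj_onI)
  then have "bij_betw f (tverts S) (tverts T)"
    using f_verts surj T unfolding bij_betw_def weighted_rooted_tree_def by blast
  moreover have "(u, v) \<in> tarcs S \<longleftrightarrow> (f u, f v) \<in> tarcs T" if "u \<in> tverts S" "v \<in> tverts S" for u v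
  proof
    assume "(f u, f v) \<in> tarcs T"
    then obtain v' where v': "(u, v') \<in> tarcs S" "f v = f v'" using f_arc_ex \<open>u \<in> tverts S\<close> by blast
    then have "v' \<in> tverts S" using wrtree_arcs_subset[OF S] by blast
    with v' show "(u, v) \<in> tarcs S" using inj_onD[OF inj_f] that(2) by blast
  qed (rule f_arc)
  moreover have "tweight T (f v) = tweight S v" if "v \<in> tverts S" for v
    using canon_f[OF reachS[OF that]] rweight_canon[OF S, of v] rweight_canon[OF T, of "f v"] by simp
  ultimately show ?thesis
    unfolding wrtree_iso_def using f_root by blast
qed

lemma wrtree_iso_iff_canon_eq:
  assumes "weighted_rooted_tree S" and "weighted_rooted_tree T"
  shows "wrtree_iso S T \<longleftrightarrow> canon S (troot S) = canon T (troot T)"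
  using assms canon_iso iso_of_canon_eq by metis

lemma positive_canon:
  assumes T: "weighted_rooted_tree T" and "v \<in> tverts T"
  shows "positive (canon T v)"
  using \<open>v \<in> tverts T\<close>
proof (induction v rule: wf_induct_rule[OF wf_tarcs_converse[OF T]])
  case (1 v)
  have "positive (canon T c)" if "(v, c) \<in> tarcs T" for c
    using 1(1)[of c] that wrtree_arcs_subset[OF T] by blast
  then show ?case
    using T 1(2) finite_children[OF T]
    by (subst positive_iff) (auto simp: rweight_canon kids_canon weighted_rooted_tree_def)
qed

section \<open>Realizing a hereditary multiset as a tree of paths\<close>

text \<open>An arbitrary but fixed enumeration of the children, so that a vertex can be named by the
  list of indices leading to it.\<close>

definition kid_list :: "wtree \<Rightarrow> wtree list" where
  "kid_list t = (SOME xs. mset xs = kids t)"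

lemma mset_kid_list: "mset (kid_list t) = kids t"
  unfolding kid_list_def by (rule someI_ex) (rule ex_mset)

lemma nth_kid_list: "i < length (kid_list t) \<Longrightarrow> kid_list t ! i \<in># kids t"
  by (metis mset_kid_list nth_mem_mset)

text \<open>Carries meaning only along valid index paths, which \<open>position\<close> singles
  out.\<close>

primrec subtree_at :: "nat list \<Rightarrow> wtree \<Rightarrow> wtree" where
  "subtree_at [] t = t"
| "subtree_at (i # p) t = subtree_at p (kid_list t ! i)"

primrec position :: "nat list \<Rightarrow> wtree \<Rightarrow> bool" where
  "position [] t \<longleftrightarrow> True"
| "position (i # p) t \<longleftrightarrow> i < length (kid_list t) \<and> position p (kid_list t ! i)"

lemma subtree_at_snoc: "subtree_at (p @ [i]) t = kid_list (subtree_at p t) ! i"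
  by (induction p arbitrary: t) simp_all

lemma position_snoc:
  "position (p @ [i]) t \<longleftrightarrow> position p t \<and> i < length (kid_list (subtree_at p t))"
  by (induction p arbitrary: t) auto

lemma positive_subtree_at: "positive t \<Longrightarrow> position p t \<Longrightarrow> positive (subtree_at p t)"
proof (induction p arbitrary: t)
  case (Cons i p)
  then show ?case using nth_kid_list[of i t] positive_iff[of t] by simp
qed simp

lemma positions_decomp:
  "{p. position p t} =
     insert [] (\<Union>i < length (kid_list t). (#) i ` {p. position p (kid_list t ! i)})"
proof (intro set_eqI)
  fix p
  show "p \<in> {p. position p t} \<longleftrightarrow>
      p \<in> insert [] (\<Union>i < length (kid_list t). (#) i ` {p. position p (kid_list t ! i)})"
    by (cases p) auto
qed

lemma size_kid: "s \<in># kids t \<Longrightarrow> size s < size t"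
  by (cases t) (auto dest!: multi_member_split)

text \<open>Paths through different children differ in their first index, so the sum splits into
  disjoint blocks. Finiteness is proved alongside because the splitting relies on it.\<close>

lemma positions_finite_sum:
  "finite {p. position p t} \<and> (\<Sum>p | position p t. rweight (subtree_at p t)) = tweight_sum t"
proof (induction t rule: measure_induct_rule[of size])
  case (less t)
  let ?n = "length (kid_list t)"
  have IH: "finite {p. position p (kid_list t ! i)}"
    "(\<Sum>p | position p (kid_list t ! i). rweight (subtree_at p (kid_list t ! i))) =
      tweight_sum (kid_list t ! i)" if "i < ?n" for i
    using less[of "kid_list t ! i"] nth_kid_list[OF that]
    by (simp_all add: size_kid)
  have fin: "finite (\<Union>i < ?n. (#) i ` {p. position p (kid_list t ! i)})"
    using IH(1) by auto
  have "(\<Sum>p \<in> (\<Union>i < ?n. (#) i ` {p. position p (kid_list t ! i)}). rweight (subtree_at p t)) =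
      (\<Sum>i < ?n. \<Sum>p \<in> (#) i ` {p. position p (kid_list t ! i)}. rweight (subtree_at p t))"
    using IH(1) by (intro sum.UNION_disjoint) auto
  also have "\<dots> = (\<Sum>i < ?n. tweight_sum (kid_list t ! i))"
    using IH(2) by (intro sum.cong) (simp_all add: sum.reindex)
  also have "\<dots> = sum_mset (image_mset tweight_sum (kids t))"
    using sum_mset_sum_list[of "map tweight_sum (kid_list t)"]
    by (simp add: mset_kid_list sum_list_sum_nth atLeast0LessThan)
  finally show ?case
    using fin by (simp add: positions_decomp[of t] weight_kids[of t] image_iff)
qed

text \<open>Index paths serve as vertices, which keeps repeated copies of an equal subtree
  apart.\<close>

definition realization :: "wtree \<Rightarrow> nat list wrtree" where
  "realization t = \<lparr>tverts = {p. position p t}, tarcs = {(p, p @ [i]) | p i. position (p @ [i]) t},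
     troot = [], tweight = \<lambda>p. rweight (subtree_at p t)\<rparr>"

lemma weighted_rooted_tree_realization:
  assumes "positive t"
  shows "weighted_rooted_tree (realization t)"
proof -
  have "([], p) \<in> (tarcs (realization t))\<^sup>*" if "position p t" for p
    using that
  proof (induction p rule: rev_induct)
    case (snoc i p)
    then have "(p, p @ [i]) \<in> tarcs (realization t)" by (auto simp: realization_def)
    with snoc show ?case by (auto simp: position_snoc)
  qed simp
  moreover have "0 < rweight (subtree_at p t)" if "position p t" for p
    using positive_subtree_at[OF assms that] positive_iff by blast
  moreover have "\<exists>!q. (q, p) \<in> tarcs (realization t)" if "position p t" "p \<noteq> []" for p
    using that by (cases p rule: rev_cases) (auto simp: realization_def)
  ultimately show ?thesis
    using positions_finite_sum[of t]
    by (auto simp: weighted_rooted_tree_def realization_def position_snoc)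
qed

text \<open>Stated at every position, not only the root, so that induction from the leaves upward
  goes through.\<close>

lemma canon_realization:
  assumes "positive t" "position p t"
  shows "canon (realization t) p = subtree_at p t"
  using \<open>position p t\<close>
proof (induction p rule: wf_induct_rule[OF
      wf_tarcs_converse[OF weighted_rooted_tree_realization[OF \<open>positive t\<close>]]])
  case (1 p)
  note R = weighted_rooted_tree_realization[OF \<open>positive t\<close>]
  let ?n = "length (kid_list (subtree_at p t))"
  have arcs: "tarcs (realization t) `` {p} = (\<lambda>i. p @ [i]) ` {..<?n}"
    using 1(2) by (auto simp: realization_def position_snoc)
  have "image_mset (canon (realization t)) (mset_set (tarcs (realization t) `` {p})) =
      image_mset (\<lambda>i. canon (realization t) (p @ [i])) (mset_set {..<?n})"
    unfolding arcs by (subst image_mset_mset_set[symmetric])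
      (auto intro: inj_onI simp: multiset.map_comp comp_def)
  also have "\<dots> = image_mset (\<lambda>i. kid_list (subtree_at p t) ! i) (mset_set {..<?n})"
  proof (rule image_mset_cong)
    fix i assume "i \<in># mset_set {..<?n}"
    then have "position (p @ [i]) t" using 1(2) by (simp add: position_snoc)
    with 1(1)[of "p @ [i]"] show "canon (realization t) (p @ [i]) = kid_list (subtree_at p t) ! i"
      by (auto simp: realization_def subtree_at_snoc)
  qed
  also have "\<dots> = mset (map ((!) (kid_list (subtree_at p t))) [0..<?n])"
    by (simp add: atLeast0LessThan)
  also have "\<dots> = kids (subtree_at p t)"
    by (simp only: map_nth mset_kid_list)
  finally show ?case
    by (subst canon_eq[OF R]) (simp add: realization_def)
qed

lemma total_weight_realization: "total_weight (realization t) = tweight_sum t"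
  using positions_finite_sum[of t] by (simp add: total_weight_def realization_def)

text \<open>\<open>T\<close> is isomorphic to the realization of its canonical form, whose total
  weight is already known.\<close>

lemma total_weight_canon:
  assumes T: "weighted_rooted_tree T"
  shows "total_weight T = tweight_sum (canon T (troot T))"
proof -
  let ?t = "canon T (troot T)"
  have pos: "positive ?t" using positive_canon[OF T troot_in_tverts[OF T]] .
  have "canon (realization ?t) (troot (realization ?t)) = ?t"
    using canon_realization[OF pos, of "[]"] by (simp add: realization_def)
  then have "wrtree_iso T (realization ?t)"
    using iso_of_canon_eq[OF T weighted_rooted_tree_realization[OF pos]] by simp
  then show ?thesis
    using wrtree_iso_total_weight total_weight_realization by metis
qed

lemma ex_nat_wrtree_canon:
  assumes "positive t"
  shows "\<exists>T :: nat wrtree. weighted_rooted_tree T \<and> canon T (troot T) = t"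
proof -
  note R = weighted_rooted_tree_realization[OF assms]
  have "canon (realization t) (troot (realization t)) = t"
    using canon_realization[OF assms, of "[]"] by (simp add: realization_def)
  then show ?thesis
    using wrtree_iso_nat[OF R] canon_iso[OF R] by metis
qed

section \<open>Limbs\<close>

text \<open>Limbs indexed by the set \<open>C\<close> of chosen children instead of a collection of
  branches; \<open>limbs_eq\<close> shows that both descriptions agree.\<close>

definition limb :: "'a wrtree \<Rightarrow> 'a \<Rightarrow> 'a set \<Rightarrow> 'a wrtree" where
  "limb T v C = \<lparr>tverts = insert v ((tarcs T)\<^sup>* `` C),
     tarcs = {v} \<times> C \<union> tarcs T \<inter> (tarcs T)\<^sup>* `` C \<times> UNIV,
     troot = v, tweight = tweight T\<rparr>"

lemma not_reach_parent:
  assumes "weighted_rooted_tree T" and "(v, c) \<in> tarcs T"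
  shows "(c, v) \<notin> (tarcs T)\<^sup>*"
  using acyclic_tarcs[OF assms(1)] assms(2)
  by (meson acyclic_def rtrancl_into_trancl2)

text \<open>A nontrivial path into \<open>d\<close> ends with the arc from its parent
  \<open>v\<close>, so \<open>c\<close> would reach its own parent.\<close>

lemma sibling_reach:
  assumes "weighted_rooted_tree T" and "(v, c) \<in> tarcs T" and "(v, d) \<in> tarcs T"
    and "(c, d) \<in> (tarcs T)\<^sup>*"
  shows "c = d"
  using assms(4)
proof (cases rule: rtranclE)
  case (step u)
  then have "u = v" using parent_unique[OF assms(1)] assms(3) by blast
  then show ?thesis using step(1) not_reach_parent[OF assms(1,2)] by blast
qed

text \<open>A branch has all arcs induced on its vertices. None of them enters \<open>v\<close>, and
  the only one leaving \<open>v\<close> goes to \<open>c\<close>, since \<open>c\<close> reaches no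
  sibling.\<close>

lemma branch_eq_limb:
  assumes "weighted_rooted_tree T" and "(v, c) \<in> tarcs T"
  shows "branch T v c = limb T v {c}"
proof -
  have "(x, v) \<notin> (tarcs T)" if "(c, x) \<in> (tarcs T)\<^sup>*" for x
    using not_reach_parent[OF assms] that by (meson rtrancl.rtrancl_into_rtrancl)
  moreover have "(v, v) \<notin> tarcs T"
    using not_reach_parent[OF assms(1)] by blast
  ultimately show ?thesis
    using assms sibling_reach[OF assms] not_reach_parent[OF assms]
    by (auto simp: branch_def limb_def Let_def intro: rtrancl.rtrancl_into_rtrancl)
qed

lemma limbs_eq:
  fixes T :: "'a wrtree"
  assumes T: "weighted_rooted_tree T"
  shows "limbs T v = limb T v ` Pow (tarcs T `` {v})"
proof -
  define merge where "merge \<B> = \<lparr>tverts = insert v (\<Union>B \<in> \<B>. tverts B),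
      tarcs = (\<Union>B \<in> \<B>. tarcs B), troot = v, tweight = tweight T\<rparr>" for \<B> :: "'a wrtree set"
  \<comment> \<open>Vertices and arcs below \<open>C\<close> are unions over its elements, so
    merging branches unites their sets of children.\<close>
  have merge: "merge (branch T v ` C) = limb T v C" if "C \<subseteq> tarcs T `` {v}" for C
  proof -
    have "branch T v ` C = (\<lambda>c. limb T v {c}) ` C"
      using that by (intro image_cong) (auto simp: branch_eq_limb[OF T])
    then show ?thesis by (auto simp: merge_def limb_def)
  qed
  have "limbs T v = merge ` Pow (branches T v)"
    by (auto simp: limbs_def merge_def)
  also have "branches T v = branch T v ` (tarcs T `` {v})"
    by (auto simp: branches_def)
  also have "merge ` Pow (branch T v ` (tarcs T `` {v})) = limb T v ` Pow (tarcs T `` {v})"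
    by (simp add: image_Pow_surj[OF refl, symmetric] image_image merge)
  finally show ?thesis .
qed

lemma
  assumes T: "weighted_rooted_tree T" and v: "v \<in> tverts T" and C: "C \<subseteq> tarcs T `` {v}"
  shows weighted_rooted_tree_limb: "weighted_rooted_tree (limb T v C)"
    and canon_limb: "canon (limb T v C) v = Node (tweight T v) (image_mset (canon T) (mset_set C))"
proof -
  let ?E = "tarcs T" and ?M = "limb T v C" and ?D = "(tarcs T)\<^sup>* `` C"
  have D_verts: "?D \<subseteq> tverts T"
  proof -
    have "x \<in> tverts T" if "(c, x) \<in> ?E\<^sup>*" "c \<in> tverts T" for c x
      using that wrtree_arcs_subset[OF T] by (induction rule: rtrancl_induct) auto
    then show ?thesis using C wrtree_arcs_subset[OF T] by blast
  qed
  have D_closed: "x \<in> ?D" if "u \<in> ?D" "(u, x) \<in> ?E" for u x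
    using that by (meson Image_iff rtrancl.rtrancl_into_rtrancl)
  have CD: "C \<subseteq> ?D" by blast
  have v_notin: "v \<notin> ?D" using not_reach_parent[OF T] C by blast
  have arcsM: "(u, x) \<in> tarcs ?M \<longleftrightarrow> u = v \<and> x \<in> C \<or> u \<in> ?D \<and> (u, x) \<in> ?E" for u x
    by (auto simp: limb_def)
  have sub: "tarcs ?M \<subseteq> ?E" using C by (auto simp: limb_def)
  have "\<exists>!u. (u, x) \<in> tarcs ?M" if "x \<in> ?D" for x
  proof -
    from that obtain c where c: "c \<in> C" "(c, x) \<in> ?E\<^sup>*" by blast
    \<comment> \<open>For a trivial path the parent is \<open>v\<close>; otherwise the last arc
      starts among the descendants of \<open>C\<close>.\<close>
    have "\<exists>u. (u, x) \<in> tarcs ?M"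
      using c(2) by (cases rule: rtranclE) (use c(1) arcsM in blast)+
    then show ?thesis using sub parent_unique[OF T] by blast
  qed
  moreover have "(v, x) \<in> (tarcs ?M)\<^sup>*" if "x \<in> ?D" for x
  proof -
    from that obtain c where c: "c \<in> C" "(c, x) \<in> ?E\<^sup>*" by blast
    from c(2) show ?thesis
    proof induction
      case base
      show ?case using c(1) arcsM by blast
    next
      case (step y z)
      then have "(y, z) \<in> tarcs ?M" using c(1) arcsM by blast
      with step.IH show ?case by (rule rtrancl.rtrancl_into_rtrancl)
    qed
  qed
  moreover have "(u, v) \<notin> tarcs ?M" for u
    using arcsM v_notin D_closed CD by blast
  moreover have "tarcs ?M \<subseteq> tverts ?M \<times> tverts ?M"
    using arcsM D_closed CD by (auto simp: limb_def intro: rtrancl.rtrancl_into_rtrancl)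
  moreover have "tverts ?M = insert v ?D" "troot ?M = v" "tweight ?M = tweight T"
    by (simp_all add: limb_def)
  ultimately show M: "weighted_rooted_tree ?M"
    using D_verts v finite_tverts[OF T] T finite_subset[OF D_verts]
    unfolding weighted_rooted_tree_def by auto
  \<comment> \<open>The descendants of \<open>C\<close> are child-closed and exclude
    \<open>v\<close>, so the limb and \<open>T\<close> have the same arcs there.\<close>
  have canon_D: "canon ?M u = canon T (id u)" if "u \<in> ?D" for u
  proof (rule canon_transfer[OF M T, of id ?D, symmetric])
    fix u assume u: "u \<in> ?D"
    then have eq: "tarcs ?M `` {u} = ?E `` {u}" using arcsM v_notin by auto
    then show "tarcs T `` {id u} = id ` (tarcs ?M `` {u})" by simp
    show "tarcs ?M `` {u} \<subseteq> ?D" unfolding eq using D_closed u by blast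
    show "tweight T (id u) = tweight ?M u" by (simp add: limb_def)
  qed (use that in simp_all)
  have "image_mset (canon ?M) (mset_set C) = image_mset (canon T) (mset_set C)"
    using CD finite_subset[OF C finite_children[OF T]] canon_D
    by (intro image_mset_cong) (simp add: subset_iff)
  moreover have "tarcs ?M `` {v} = C" using arcsM v_notin by auto
  ultimately show "canon ?M v = Node (tweight T v) (image_mset (canon T) (mset_set C))"
    by (subst canon_eq[OF M]) (simp add: limb_def)
qed

text \<open>A submultiset of the image lifts to some \<open>M\<close> below
  \<open>mset_set A\<close>. Its multiplicities are at most one, so \<open>M\<close> comes from a
  set.\<close>

lemma subset_image_mset_set_iff:
  assumes "finite A"
  shows "K \<subseteq># image_mset f (mset_set A) \<longleftrightarrow> (\<exists>C \<subseteq> A. image_mset f (mset_set C) = K)"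
proof
  assume "K \<subseteq># image_mset f (mset_set A)"
  then obtain K' where "image_mset f (mset_set A) = K + K'"
    by (auto simp: subset_mset.le_iff_add)
  then obtain M N where M: "mset_set A = M + N" "K = image_mset f M"
    using image_mset_eq_plusD by blast
  then have "M \<subseteq># mset_set A" by simp
  then have "set_mset M \<subseteq> A"
    using assms by (metis finite_set_mset_mset_set set_mset_mono)
  moreover have "mset_set (set_mset M) = M"
  proof (rule subset_mset.antisym)
    show "M \<subseteq># mset_set (set_mset M)"
    proof (rule mset_subset_eqI)
      fix x
      have "count M x \<le> count (mset_set A) x"
        using \<open>M \<subseteq># mset_set A\<close> by (rule mset_subset_eq_count)
      also have "\<dots> \<le> 1" by (simp add: count_mset_set')
      finally show "count M x \<le> count (mset_set (set_mset M)) x"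
        by (cases "x \<in># M") (simp_all add: not_in_iff)
    qed
  qed (rule mset_set_set_mset_msubset)
  ultimately show "\<exists>C \<subseteq> A. image_mset f (mset_set C) = K" using M(2) by metis
next
  assume "\<exists>C \<subseteq> A. image_mset f (mset_set C) = K"
  then show "K \<subseteq># image_mset f (mset_set A)"
    using assms by (auto intro!: image_mset_subseteq_mono subset_imp_msubset_mset_set)
qed

text \<open>Choosing children at a vertex corresponds to \<open>here\<close>, and the path from the
  root to that vertex to a chain of \<open>there\<close> steps.\<close>

lemma has_limb_iff_contains_limb:
  assumes T: "weighted_rooted_tree T" and L: "weighted_rooted_tree L"
  shows "has_limb T L \<longleftrightarrow> contains_limb (canon L (troot L)) (canon T (troot T))"
proof -
  let ?L = "canon L (troot L)"
  have at_v: "(\<exists>M \<in> limbs T v. wrtree_iso M L) \<longleftrightarrow>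
      rweight (canon T v) = rweight ?L \<and> kids ?L \<subseteq># kids (canon T v)"
    if v: "v \<in> tverts T" for v
  proof -
    have "wrtree_iso (limb T v C) L \<longleftrightarrow>
        tweight T v = rweight ?L \<and> image_mset (canon T) (mset_set C) = kids ?L"
      if "C \<subseteq> tarcs T `` {v}" for C
    proof -
      have "troot (limb T v C) = v" by (simp add: limb_def)
      then show ?thesis
        using wrtree_iso_iff_canon_eq[OF weighted_rooted_tree_limb[OF T v that] L]
          canon_limb[OF T v that] by (cases ?L) simp
    qed
    then show ?thesis
      using subset_image_mset_set_iff[OF finite_children[OF T], of "kids ?L" "canon T"]
      by (auto simp: limbs_eq[OF T] rweight_canon[OF T] kids_canon[OF T])
  qed
  show ?thesis
  proof
    assume "has_limb T L"
    then obtain v where v: "v \<in> tverts T" "\<exists>M \<in> limbs T v. wrtree_iso M L"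
      unfolding has_limb_def by blast
    then have "contains_limb ?L (canon T v)" using at_v by (auto intro: contains_limb.here)
    moreover have "contains_limb ?L (canon T u)"
      if "(u, v) \<in> (tarcs T)\<^sup>*" "contains_limb ?L (canon T v)" for u
      using that
    proof (induction rule: converse_rtrancl_induct)
      case (step y z)
      then have "canon T z \<in># kids (canon T y)"
        using finite_children[OF T] by (simp add: kids_canon[OF T])
      then show ?case using step by (blast intro: contains_limb.there)
    qed
    ultimately show "contains_limb ?L (canon T (troot T))"
      using T v(1) by (simp add: weighted_rooted_tree_def)
  next
    have "\<exists>v \<in> tverts T. \<exists>M \<in> limbs T v. wrtree_iso M L"
      if "contains_limb ?L t" "t = canon T u" "u \<in> tverts T" for t u
      using that
    proof (induction arbitrary: u)
      case (here t)
      then show ?case using at_v by blast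
    next
      case (there s t)
      then obtain c where "(u, c) \<in> tarcs T" "s = canon T c"
        using finite_children[OF T] by (auto simp: kids_canon[OF T])
      then show ?case using there.IH[of c] wrtree_arcs_subset[OF T] by blast
    qed
    moreover assume "contains_limb ?L (canon T (troot T))"
    ultimately show "has_limb T L"
      using troot_in_tverts[OF T] unfolding has_limb_def by blast
  qed
qed

section \<open>Counting isomorphism classes by canonical forms\<close>

lemma bij_betw_image_quotient:
  assumes "equiv A r" "X \<subseteq> A" "\<And>x y. x \<in> X \<Longrightarrow> y \<in> X \<Longrightarrow> (x, y) \<in> r \<longleftrightarrow> f x = f y"
  shows "\<exists>g. bij_betw g (f ` X) (X // r)"
proof -
  \<comment> \<open>The class of an arbitrary preimage; \<open>cls\<close> shows that the choice
    does not matter.\<close>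
  let ?g = "\<lambda>y. r `` {inv_into X f y}"
  have inv: "inv_into X f (f x) \<in> X" "f (inv_into X f (f x)) = f x" if "x \<in> X" for x
    using that by (simp_all add: inv_into_into f_inv_into_f)
  have cls: "?g (f x) = r `` {x}" if "x \<in> X" for x
    using assms(3)[OF inv(1)[OF that] that] inv(2)[OF that]
    by (simp add: equiv_class_eq[OF assms(1)])
  have "inj_on ?g (f ` X)"
  proof (rule inj_onI, elim imageE, simp only:)
    fix x y assume "?g (f x) = ?g (f y)" "x \<in> X" "y \<in> X"
    then have "r `` {x} = r `` {y}" by (simp only: cls)
    then have "(x, y) \<in> r"
      using eq_equiv_class_iff[OF assms(1)] assms(2) \<open>x \<in> X\<close> \<open>y \<in> X\<close> by blast
    then show "f x = f y" using assms(3) \<open>x \<in> X\<close> \<open>y \<in> X\<close> by blast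
  qed
  moreover have "?g ` (f ` X) = X // r"
    using cls by (auto simp: quotient_def image_image)
  ultimately show ?thesis unfolding bij_betw_def by blast
qed

text \<open>With \<open>P\<close> constantly true this transfers finiteness to canonical forms; with
  \<open>P\<close> the containment of a limb it transfers the count.\<close>

lemma bij_betw_classes:
  "\<exists>g. bij_betw g {t. positive t \<and> tweight_sum t = n \<and> P t}
     ({T :: nat wrtree. weighted_rooted_tree T \<and> total_weight T = n \<and> P (canon T (troot T))}
      // wrtree_iso_rel)"
proof -
  let ?X = "{T :: nat wrtree. weighted_rooted_tree T \<and> total_weight T = n \<and> P (canon T (troot T))}"
  have "{t. positive t \<and> tweight_sum t = n \<and> P t} = (\<lambda>T. canon T (troot T)) ` ?X"
  proof (intro equalityI subsetI)
    fix t assume t: "t \<in> {t. positive t \<and> tweight_sum t = n \<and> P t}"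
    then obtain T :: "nat wrtree" where "weighted_rooted_tree T" "canon T (troot T) = t"
      using ex_nat_wrtree_canon by blast
    with t total_weight_canon[of T] show "t \<in> (\<lambda>T. canon T (troot T)) ` ?X" by auto
  next
    fix t assume "t \<in> (\<lambda>T. canon T (troot T)) ` ?X"
    then show "t \<in> {t. positive t \<and> tweight_sum t = n \<and> P t}"
      by (auto simp: positive_canon troot_in_tverts total_weight_canon)
  qed
  moreover have "\<exists>g. bij_betw g ((\<lambda>T. canon T (troot T)) ` ?X) (?X // wrtree_iso_rel)"
    by (rule bij_betw_image_quotient[OF equiv_wrtree_iso_rel])
      (auto simp: wrtree_iso_rel_def wrtree_iso_iff_canon_eq)
  ultimately show ?thesis by simp
qed

lemma finite_positive_weight: "finite {t. positive t \<and> tweight_sum t = n}"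
  using bij_betw_classes[of n "\<lambda>_. True"] finite_wrtree_classes[of n] bij_betw_finite by auto

lemma num_trees_with_limb_eq:
  assumes "weighted_rooted_tree L"
  shows "num_trees_with_limb n L =
    card {t. positive t \<and> tweight_sum t = n \<and> contains_limb (canon L (troot L)) t}"
proof -
  have "{T :: nat wrtree. weighted_rooted_tree T \<and> total_weight T = n \<and> has_limb T L} =
      {T. weighted_rooted_tree T \<and> total_weight T = n \<and>
        contains_limb (canon L (troot L)) (canon T (troot T))}"
    using has_limb_iff_contains_limb[OF _ assms] by auto
  then show ?thesis
    using bij_betw_classes[of n "contains_limb (canon L (troot L))"]
    by (auto simp: num_trees_with_limb_def dest: bij_betw_same_card)
qed

theorem mainTheorem3:
  fixes L1 :: "'a wrtree" and L2 :: "'b wrtree" and l n :: nat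
  assumes "weighted_rooted_tree L1" and "weighted_rooted_tree L2"
    and "card (tverts L1) \<ge> 3" and "card (tverts L2) \<ge> 3"
    and "total_weight L1 = l" and "total_weight L2 = l"
  shows "num_trees_with_limb n L1 = num_trees_with_limb n L2"
proof -
  \<comment> \<open>There are finitely many trees of weight \<open>n\<close>, so equal numbers of
    avoiding trees force equal numbers of containing ones.\<close>
  have split: "card {t. positive t \<and> tweight_sum t = n} =
      card {t. positive t \<and> tweight_sum t = n \<and> contains_limb L t} +
      card {t. positive t \<and> tweight_sum t = n \<and> \<not> contains_limb L t}" for L
    by (subst card_Un_disjoint[symmetric])
      (auto intro: arg_cong[where f = card] finite_subset[OF _ finite_positive_weight[of n]])
  have "card {t. positive t \<and> tweight_sum t = n \<and> \<not> contains_limb (canon L1 (troot L1)) t} =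
      card {t. positive t \<and> tweight_sum t = n \<and> \<not> contains_limb (canon L2 (troot L2)) t}"
  proof (rule card_avoiding_eq[OF finite_positive_weight])
    show "positive (canon L1 (troot L1))" "positive (canon L2 (troot L2))"
      using assms(1,2) by (simp_all add: positive_canon troot_in_tverts)
    show "tweight_sum (canon L1 (troot L1)) = tweight_sum (canon L2 (troot L2))"
      using assms(5,6) total_weight_canon[OF assms(1)] total_weight_canon[OF assms(2)] by simp
  qed
  then show ?thesis
    using split[of "canon L1 (troot L1)"] split[of "canon L2 (troot L2)"]
    by (simp add: num_trees_with_limb_eq[OF assms(1)] num_trees_with_limb_eq[OF assms(2)])
qed

end
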